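(* Let $k\ge 2$ and $n=k+2$. Suppose the planar variables $s_{23},s_{34},\ldots,s_{k+1,k+2}$ are positive reals. Then for $\alpha'>0$ the stringy integral $$ \mathcal I_{\Delta_{k-1}}=(\alpha')^{k-1}\int_{\mathbb R_{\ge0}^{k-1}}\prod_{i=1}^{k-1}\frac{dx_i}{x_i}\,x_i^{\alpha' s_{i+2,i+3}}\,\bigl(1+x_1+\cdots+x_{k-1}\bigr)^{-\alpha'\sum_{i=2}^{k+1}s_{i,i+1}} $$ evaluates to $$ \mathcal I_{\Delta_{k-1}}=(\alpha')^{k-1}\,\frac{\Gamma(\alpha's_{23})\,\Gamma(\alpha's_{34})\cdots\Gamma(\alpha's_{k+1,k+2})}{\Gamma\bigl(\alpha'(s_{23}+s_{34}+\cdots+s_{k+1,k+2})\bigr)}, $$ and its limit $m_{\Delta_{k-1}}:=\lim_{\alpha'\to0}\mathcal I_{\Delta_{k-1}}$ (the simplex amplitude) coincides with the restriction of the $(k+2)$-point biadjoint scalar amplitude to simplex kinematics: $$ m_{\Delta_{k-1}}\;=\;m^{(2)}_{k+2}\Big|_{\mathcal K_\Delta}\;=\;\frac{\sum_{i=2}^{k+1}s_{i,i+1}}{\prod_{i=2}^{k+1}s_{i,i+1}}. $$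
   Context: **Mandelstam invariants.** The $n$-particle Mandelstam invariants are numbers $s_{ij}=s_{ji}$ ($1\le i\ne j\le n$) satisfying momentum conservation $\sum_{j\ne i}s_{ij}=0$ for each $i$. **Simplex kinematics.** $\mathcal K_\Delta$ is the subspace of kinematic space on which $s_{ij}=0$ for every pair $\{i,j\}$ other than $\{1,j\}$ ($j=2,\ldots,n$), $\{i,i+1\}$ ($i=2,\ldots,n-1$), and $\{2,n\}$. **Biadjoint scalar amplitude.** $m_n^{(2)}$ (for the canonical ordering $(12\cdots n)$) is the rational function $$m_n^{(2)}=\sum_{T}\ \prod_{D\in T}\frac1{s_D},$$ where $T$ runs over all triangulations of a convex $n$-gon whose edges are labeled cyclically by $1,\ldots,n$, and $D$ runs over the $n-3$ diagonals of $T$. A diagonal $D$ separates the edge labels into two cyclic intervals $A$ and $[n]\setminus A$, and $s_D:=\sum_{\{i,j\}\subseteq A}s_{ij}$ (the same for both intervals, by momentum conservation). For example, $m_5^{(2)}=\frac1{s_{12}s_{34}}+\frac1{s_{12}s_{45}}+\frac1{s_{23}s_{45}}+\frac1{s_{15}s_{23}}+\frac1{s_{15}s_{34}}$. *)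

theory Defs
  imports "HOL-Analysis.Analysis"
begin

text \<open>
  Kinematic data are functions of two particle labels, constrained only on pairs of
  distinct labels in \<open>{1..n}\<close>.
\<close>

definition kinematic_space :: "nat \<Rightarrow> (nat \<Rightarrow> nat \<Rightarrow> real) set" where
  "kinematic_space n =
    {s. (\<forall>i\<in>{1..n}. \<forall>j\<in>{1..n}. i \<noteq> j \<longrightarrow> s i j = s j i) \<and>
        (\<forall>i\<in>{1..n}. (\<Sum>j\<in>{1..n} - {i}. s i j) = 0)}"

definition simplex_kinematics :: "nat \<Rightarrow> (nat \<Rightarrow> nat \<Rightarrow> real) set" where
  "simplex_kinematics n =
    {s \<in> kinematic_space n. \<forall>i\<in>{1..n}. \<forall>j\<in>{1..n}.
       i < j \<and> i \<noteq> 1 \<and> j \<noteq> i + 1 \<and> (i, j) \<noteq> (2, n) \<longrightarrow> s i j = 0}"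

text \<open>
  The vertices of the \<open>n\<close>-gon are numbered so that vertex \<open>i\<close> lies between the edges
  \<open>i\<close> and \<open>i + 1\<close> (vertex \<open>n\<close> between the edges \<open>n\<close> and \<open>1\<close>). A diagonal is given by its two
  end vertices \<open>a < b\<close>; it separates the edges \<open>a + 1, \<dots>, b\<close> from the others. The pair
  \<open>(1, n)\<close> is excluded since it is the edge \<open>1\<close>.
\<close>

definition diagonals :: "nat \<Rightarrow> (nat \<times> nat) set" where
  "diagonals n = {(a, b). 1 \<le> a \<and> a + 2 \<le> b \<and> b \<le> n \<and> (a, b) \<noteq> (1, n)}"

definition crossing :: "nat \<times> nat \<Rightarrow> nat \<times> nat \<Rightarrow> bool" where
  "crossing D E \<longleftrightarrow>
    fst D < fst E \<and> fst E < snd D \<and> snd D < snd E \<or>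
    fst E < fst D \<and> fst D < snd E \<and> snd E < snd D"

definition triangulations :: "nat \<Rightarrow> (nat \<times> nat) set set" where
  "triangulations n =
    {T. T \<subseteq> diagonals n \<and> (\<forall>D\<in>T. \<forall>E\<in>T. \<not> crossing D E) \<and>
        (\<forall>D\<in>diagonals n. (\<forall>E\<in>T. \<not> crossing D E) \<longrightarrow> D \<in> T)}"

text \<open>
  Of the two intervals cut out by a diagonal, the one not containing the label \<open>1\<close> is used; on
  \<open>kinematic_space n\<close> the complementary interval gives the same value.
\<close>

definition diagonal_invariant :: "(nat \<Rightarrow> nat \<Rightarrow> real) \<Rightarrow> nat \<times> nat \<Rightarrow> real" where
  "diagonal_invariant s D =
    (\<Sum>(i, j) \<in> {(i, j). i \<in> {fst D<..snd D} \<and> j \<in> {fst D<..snd D} \<and> i < j}. s i j)"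

definition biadjoint_amplitude :: "nat \<Rightarrow> (nat \<Rightarrow> nat \<Rightarrow> real) \<Rightarrow> real" where
  "biadjoint_amplitude n s =
    (\<Sum>T\<in>triangulations n. \<Prod>D\<in>T. 1 / diagonal_invariant s D)"

text \<open>
  The conventions \<open>1 / 0 = 0\<close> and \<open>0 powr a = 0\<close> affect the integrand only on the coordinate
  hyperplanes, a null set.
\<close>

definition stringy_integrand :: "nat \<Rightarrow> real \<Rightarrow> (nat \<Rightarrow> nat \<Rightarrow> real) \<Rightarrow> (nat \<Rightarrow> real) \<Rightarrow> real" where
  "stringy_integrand k \<alpha> s x =
    (\<Prod>i=1..k-1. 1 / x i * x i powr (\<alpha> * s (i + 2) (i + 3))) *
    (1 + (\<Sum>i=1..k-1. x i)) powr (- \<alpha> * (\<Sum>i=2..k+1. s i (i + 1)))"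

definition stringy_integral :: "nat \<Rightarrow> real \<Rightarrow> (nat \<Rightarrow> nat \<Rightarrow> real) \<Rightarrow> real" where
  "stringy_integral k \<alpha> s =
    \<alpha> ^ (k - 1) *
    (LINT x : PiE {1..k-1} (\<lambda>_. {0..}) | PiM {1..k-1} (\<lambda>_. lborel). stringy_integrand k \<alpha> s x)"

definition simplex_amplitude :: "nat \<Rightarrow> (nat \<Rightarrow> nat \<Rightarrow> real) \<Rightarrow> real" where
  "simplex_amplitude k s = Lim (at_right 0) (\<lambda>\<alpha>. stringy_integral k \<alpha> s)"

text \<open>
  The planar variables \<open>s\<^sub>2\<^sub>3, s\<^sub>3\<^sub>4, \<dots>\<close> can be prescribed freely on simplex kinematics.
\<close>

lemma simplex_kinematics_planar_exists:
  fixes c :: "nat \<Rightarrow> real"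
  assumes n: "n \<ge> 4"
  shows "\<exists>s \<in> simplex_kinematics n. \<forall>i\<in>{2..n-1}. s i (i + 1) = c i"
proof -
  define S where "S = (\<Sum>i=2..n-1. c i)"
  define h where "h i = - (if i < n then c i else 0) - (if i > 2 then c (i - 1) else 0)
      + (if i = 2 then S else 0) + (if i = n then S else 0)" for i
  define g where "g i j = (if i = 1 then h j else if j = i + 1 then c i
      else if i = 2 \<and> j = n then - S else 0)" for i j
  define s where "s i j = (if i < j then g i j else g j i)" for i j
  have sym: "s i j = s j i" for i j
    by (auto simp: s_def)
  have one: "(\<Sum>j\<in>{1..n} - {1}. s 1 j) = 0"
  proof -
    have "(\<Sum>j\<in>{1..n} - {1}. s 1 j) = (\<Sum>j\<in>{2..n}. h j)"
      by (rule sum.cong) (auto simp: s_def g_def)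
    also have "\<dots> = - (\<Sum>j\<in>{2..n}. if j < n then c j else 0)
        - (\<Sum>j\<in>{2..n}. if j > 2 then c (j - 1) else 0) + S + S"
      using n by (simp add: h_def sum.distrib sum_subtractf sum_negf)
    also have "(\<Sum>j\<in>{2..n}. if j < n then c j else 0) = S"
      unfolding S_def using n
      by (intro sum.mono_neutral_cong_right) auto
    also have "(\<Sum>j\<in>{2..n}. if j > 2 then c (j - 1) else 0) = (\<Sum>j\<in>{3..n}. c (j - 1))"
      using n by (intro sum.mono_neutral_cong_right) auto
    also have "\<dots> = S"
      unfolding S_def using n
      by (intro sum.reindex_bij_witness[of _ Suc "\<lambda>j. j - 1"]) auto
    finally show ?thesis by simp
  qed
  have other: "(\<Sum>j\<in>{1..n} - {i}. s i j) = 0" if i: "i \<in> {2..n}" for i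
  proof -
    have "(\<Sum>j\<in>{1..n} - {i}. s i j) =
      (\<Sum>j\<in>{1..n} - {i}. (if j = 1 then h i else 0) + (if j = i + 1 then c i else 0)
        + (if j = i - 1 then (if i > 2 then c (i - 1) else 0) else 0)
        - (if j = n then (if i = 2 then S else 0) else 0)
        - (if j = 2 then (if i = n then S else 0) else 0))"
    proof (intro sum.cong refl)
      fix j assume "j \<in> {1..n} - {i}"
      then consider "j = 1" | "1 < j" "j < i" "j \<le> n" | "i < j" "j \<le> n"
        by force
      then show "s i j = (if j = 1 then h i else 0) + (if j = i + 1 then c i else 0)
        + (if j = i - 1 then (if i > 2 then c (i - 1) else 0) else 0)
        - (if j = n then (if i = 2 then S else 0) else 0)
        - (if j = 2 then (if i = n then S else 0) else 0)"
      proof cases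
        case 1
        moreover have "2 < i \<longrightarrow> Suc 0 \<noteq> i - Suc 0" by auto
        ultimately show ?thesis using i n by (simp add: s_def g_def)
      next
        case 2
        then have "j = i - 1 \<longleftrightarrow> i = j + 1" "i \<noteq> 2" "j \<noteq> n" "j \<noteq> i + 1" "\<not> i < j" "i > 2"
          using i by auto
        with 2 i n show ?thesis by (simp add: s_def g_def)
      next
        case 3
        then have "j \<noteq> i - 1" "i \<noteq> n" "j \<noteq> 2" "j \<noteq> 1" "i \<noteq> 1" using i by auto
        with 3 i n show ?thesis by (simp add: s_def g_def)
      qed
    qed
    also have "\<dots> = 0"
    proof -
      have "i - Suc 0 \<noteq> i" "i - Suc 0 \<in> {1..n}" "i + 1 \<in> {1..n} \<longleftrightarrow> i < n"
        using i by auto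
      then show ?thesis
        using i n by (simp add: sum.distrib sum_subtractf h_def)
    qed
    finally show ?thesis .
  qed
  have "s \<in> simplex_kinematics n"
    unfolding simplex_kinematics_def kinematic_space_def
  proof (intro CollectI conjI ballI impI)
    fix i assume "i \<in> {1..n}"
    then show "(\<Sum>j\<in>{1..n} - {i}. s i j) = 0"
      using one other by (cases "i = 1") auto
  next
    fix i j show "s i j = s j i" by (rule sym)
  next
    fix i j assume "i < j \<and> i \<noteq> 1 \<and> j \<noteq> i + 1 \<and> (i, j) \<noteq> (2, n)"
    moreover from this have "\<not> (i = 2 \<and> j = n)" by simp
    ultimately show "s i j = 0" unfolding s_def g_def by presburger
  qed
  moreover have "\<forall>i\<in>{2..n-1}. s i (i + 1) = c i"
    by (simp add: s_def g_def)
  ultimately show ?thesis by blast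
qed

end

theory Submission imports Defs begin

text \<open>
  On simplex kinematics every \<open>s\<^sub>D\<close> is a sum of the \<open>s\<^sub>i\<^sub>,\<^sub>i\<^sub>+\<^sub>1\<close> over the interior vertices
  \<open>i\<close> cut off by \<open>D\<close>. Removing the triangle at a root edge \<open>(a, b)\<close>, with apex \<open>m\<close>, splits a
  triangulation into two smaller ones; inductively the sum over triangulations, root edge
  included, is \<open>1 / \<Prod>s\<^sub>i\<^sub>,\<^sub>i\<^sub>+\<^sub>1\<close>. The amplitude leaves out the factor of the root edge
  \<open>(1, n)\<close>, which accounts for the numerator. On the analytic side the stringy integral is a
  Dirichlet integral, and its limit follows from \<open>\<alpha> \<Gamma>(\<alpha> c) = \<Gamma>(\<alpha> c + 1) / c \<rightarrow> 1 / c\<close>.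
\<close>

section \<open>Triangulations of polygons\<close>

text \<open>The polygon has the vertices \<open>a\<close>, ..., \<open>b\<close>, and its root edge
  \<open>(a, b)\<close> counts as a chord, in contrast to \<open>diagonals\<close>. With the root
  included, cutting at the triangle on the root produces objects of the same kind: the other two
  sides of that triangle are the roots of the two pieces.\<close>

definition chords :: "nat \<Rightarrow> nat \<Rightarrow> (nat \<times> nat) set" where
  "chords a b = {(p, q). a \<le> p \<and> p + 2 \<le> q \<and> q \<le> b}"

definition rooted_triangulations :: "nat \<Rightarrow> nat \<Rightarrow> (nat \<times> nat) set set" where
  "rooted_triangulations a b =
    {T. T \<subseteq> chords a b \<and> (\<forall>D\<in>T. \<forall>E\<in>T. \<not> crossing D E) \<and>
        (\<forall>D\<in>chords a b. (\<forall>E\<in>T. \<not> crossing D E) \<longrightarrow> D \<in> T)}"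

lemma finite_chords: "finite (chords a b)"
  by (rule finite_subset[of _ "{..b} \<times> {..b}"]) (auto simp: chords_def)

lemma finite_rooted_triangulations: "finite (rooted_triangulations a b)"
  by (rule finite_subset[of _ "Pow (chords a b)"])
     (auto simp: rooted_triangulations_def finite_chords)

lemma rooted_triangulations_finite_elem:
  "T \<in> rooted_triangulations a b \<Longrightarrow> finite T"
  using finite_subset[OF _ finite_chords] by (auto simp: rooted_triangulations_def)

text \<open>Base of the recursion: a polygon that degenerates to one edge has the empty
  triangulation only, so sides of the polygon carry weight 1.\<close>

lemma rooted_triangulations_trivial: "b < a + 2 \<Longrightarrow> rooted_triangulations a b = {{}}"
proof -
  assume "b < a + 2"
  then have "chords a b = {}" by (auto simp: chords_def)
  then show ?thesis by (auto simp: rooted_triangulations_def)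
qed

lemma rooted_triangulations_chords:
  "T \<in> rooted_triangulations a b \<Longrightarrow> (p, q) \<in> T \<Longrightarrow> a \<le> p \<and> p + 2 \<le> q \<and> q \<le> b"
  by (auto simp: rooted_triangulations_def chords_def)

lemma rooted_triangulations_maximal:
  "T \<in> rooted_triangulations a b \<Longrightarrow> D \<in> chords a b \<Longrightarrow> (\<And>E. E \<in> T \<Longrightarrow> \<not> crossing D E) \<Longrightarrow> D \<in> T"
  by (auto simp: rooted_triangulations_def)

text \<open>No chord crosses the root, so maximality forces it into every triangulation.\<close>

lemma root_mem: "T \<in> rooted_triangulations a b \<Longrightarrow> a + 2 \<le> b \<Longrightarrow> (a, b) \<in> T"
  by (rule rooted_triangulations_maximal) (auto simp: chords_def crossing_def dest: rooted_triangulations_chords)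

text \<open>For maximality, a chord on one side of \<open>m\<close> is handled by the piece on that
  side. A chord straddling \<open>m\<close> and different from \<open>(a, b)\<close> crosses
  \<open>(a, m)\<close> or \<open>(m, b)\<close>; the crossed edge is then long enough to be a
  chord, hence the root of its piece.\<close>

lemma glue_rooted_triangulations:
  assumes "a < m" "m < b"
    and T1: "T1 \<in> rooted_triangulations a m" and T2: "T2 \<in> rooted_triangulations m b"
  shows "insert (a, b) (T1 \<union> T2) \<in> rooted_triangulations a b"
proof -
  have sub: "T1 \<subseteq> chords a m" "T2 \<subseteq> chords m b"
    using T1 T2 by (auto simp: rooted_triangulations_def)
  have root1: "(a, m) \<in> T1" if "a + 2 \<le> m" using root_mem[OF T1 that] .
  have root2: "(m, b) \<in> T2" if "m + 2 \<le> b" using root_mem[OF T2 that] .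
  have "insert (a, b) (T1 \<union> T2) \<subseteq> chords a b"
    using sub assms(1,2) by (force simp: chords_def)
  moreover have "\<not> crossing D E"
    if "D \<in> insert (a, b) (T1 \<union> T2)" "E \<in> insert (a, b) (T1 \<union> T2)" for D E
  proof (cases "D \<in> T1 \<and> E \<in> T1 \<or> D \<in> T2 \<and> E \<in> T2")
    case True
    then show ?thesis using T1 T2 by (auto simp: rooted_triangulations_def)
  next
    case False
    with that consider "D = (a, b)" | "E = (a, b)" | "D \<in> T1" "E \<in> T2" | "D \<in> T2" "E \<in> T1"
      by blast
    then show ?thesis
    proof cases
      case 1
      have "fst E \<ge> a \<and> snd E \<le> b" using that(2) sub assms(1,2) by (auto simp: chords_def)
      with 1 show ?thesis by (simp add: crossing_def)
    next
      case 2
      have "fst D \<ge> a \<and> snd D \<le> b" using that(1) sub assms(1,2) by (auto simp: chords_def)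
      with 2 show ?thesis by (simp add: crossing_def)
    next
      case 3
      then have "snd D \<le> m" "m \<le> fst E" using sub by (auto simp: chords_def)
      then show ?thesis by (simp add: crossing_def)
    next
      case 4
      then have "snd E \<le> m" "m \<le> fst D" using sub by (auto simp: chords_def)
      then show ?thesis by (simp add: crossing_def)
    qed
  qed
  moreover have "D \<in> insert (a, b) (T1 \<union> T2)"
    if D: "D \<in> chords a b" and nc: "\<forall>E\<in>insert (a, b) (T1 \<union> T2). \<not> crossing D E" for D
  proof -
    obtain p q where [simp]: "D = (p, q)" by (cases D)
    have pq: "a \<le> p" "p + 2 \<le> q" "q \<le> b" using D by (auto simp: chords_def)
    consider "q \<le> m" | "m \<le> p" | "p < m" "m < q" by linarith
    then show ?thesis
    proof cases
      case 1
      then have "D \<in> chords a m" using pq by (simp add: chords_def)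
      then show ?thesis using T1 nc by (auto simp: rooted_triangulations_def)
    next
      case 2
      then have "D \<in> chords m b" using pq by (simp add: chords_def)
      then show ?thesis using T2 nc by (auto simp: rooted_triangulations_def)
    next
      case 3
      have "p = a"
      proof (rule ccontr)
        assume "p \<noteq> a"
        then have "(a, m) \<in> T1" using root1 pq 3 by simp
        then have "\<not> crossing D (a, m)" using nc by simp
        then show False using 3 pq \<open>p \<noteq> a\<close> by (simp add: crossing_def)
      qed
      moreover have "q = b"
      proof (rule ccontr)
        assume "q \<noteq> b"
        then have "(m, b) \<in> T2" using root2 pq 3 by simp
        then have "\<not> crossing D (m, b)" using nc by simp
        then show False using 3 pq \<open>q \<noteq> b\<close> by (simp add: crossing_def)
      qed
      ultimately show ?thesis by simp
    qed
  qed
  ultimately show ?thesis unfolding rooted_triangulations_def by blast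
qed

lemma split_rooted_triangulation:
  assumes ab: "a + 2 \<le> b" and T: "T \<in> rooted_triangulations a b"
  obtains m T1 T2 where "a < m" "m < b" "T1 \<in> rooted_triangulations a m"
    "T2 \<in> rooted_triangulations m b" "T = insert (a, b) (T1 \<union> T2)"
proof -
  have sub: "T \<subseteq> chords a b" and nc: "\<And>D E. D \<in> T \<Longrightarrow> E \<in> T \<Longrightarrow> \<not> crossing D E"
    and max: "\<And>D. D \<in> chords a b \<Longrightarrow> (\<And>E. E \<in> T \<Longrightarrow> \<not> crossing D E) \<Longrightarrow> D \<in> T"
    using T by (auto simp: rooted_triangulations_def)
  \<comment> \<open>The apex over the root is the last vertex before \<open>b\<close> joined to
    \<open>a\<close>. The vertex \<open>a + 1\<close> is added by hand because the side
    \<open>(a, a + 1)\<close> is not a chord; it also makes \<open>Q\<close> nonempty.\<close>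
  define Q where "Q = {q. q < b \<and> (q = a + 1 \<or> (a, q) \<in> T)}"
  have fin: "finite Q" by (simp add: Q_def)
  have "a + 1 \<in> Q" using ab by (simp add: Q_def)
  define m where "m = Max Q"
  have "m \<in> Q" unfolding m_def by (rule Max_in) (use fin \<open>a + 1 \<in> Q\<close> in auto)
  have above: "q \<le> m" if "q < b" "(a, q) \<in> T" for q
    unfolding m_def by (rule Max_ge) (use fin that in \<open>auto simp: Q_def\<close>)
  have "a + 1 \<le> m" unfolding m_def by (rule Max_ge) fact+
  have "m < b" and m: "m = a + 1 \<or> (a, m) \<in> T" using \<open>m \<in> Q\<close> by (auto simp: Q_def)
  \<comment> \<open>A chord starting strictly between \<open>a\<close> and \<open>m\<close> and
    ending beyond \<open>m\<close> crosses \<open>(a, m)\<close>; one from \<open>a\<close> to a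
    vertex strictly between \<open>m\<close> and \<open>b\<close> contradicts the choice of
    \<open>m\<close>.\<close>
  have straddle: "p = a \<and> q = b" if "(p, q) \<in> T" "p < m" "m < q" for p q
  proof -
    have pq: "a \<le> p" "p + 2 \<le> q" "q \<le> b" using that sub by (auto simp: chords_def)
    have "p = a"
    proof (rule ccontr)
      assume "p \<noteq> a"
      with m that pq have "(a, m) \<in> T" by auto
      from nc[OF this that(1)] that pq \<open>p \<noteq> a\<close> show False by (simp add: crossing_def)
    qed
    moreover have "\<not> q < b" using above[of q] that \<open>p = a\<close> by auto
    ultimately show ?thesis using pq by simp
  qed
  define T1 where "T1 = T \<inter> chords a m"
  define T2 where "T2 = T \<inter> chords m b"
  have T_eq: "T = insert (a, b) (T1 \<union> T2)"
  proof
    show "T \<subseteq> insert (a, b) (T1 \<union> T2)"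
    proof
      fix D assume D: "D \<in> T"
      obtain p q where [simp]: "D = (p, q)" by (cases D)
      have pq: "a \<le> p" "p + 2 \<le> q" "q \<le> b" using D sub by (auto simp: chords_def)
      consider "q \<le> m" | "m \<le> p" | "p < m" "m < q" by linarith
      then show "D \<in> insert (a, b) (T1 \<union> T2)"
        by cases (use pq D straddle[of p q] in \<open>auto simp: T1_def T2_def chords_def\<close>)
    qed
    show "insert (a, b) (T1 \<union> T2) \<subseteq> T"
      using root_mem[OF T ab] by (auto simp: T1_def T2_def)
  qed
  \<comment> \<open>A chord between \<open>a\<close> and \<open>m\<close> crosses neither the root
    nor any member of \<open>T2\<close>, so maximality of \<open>T\<close> passes to
    \<open>T1\<close>. The same holds for \<open>T2\<close> by symmetry.\<close>
  have "T1 \<in> rooted_triangulations a m"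
  proof -
    have "D \<in> T1" if D: "D \<in> chords a m" and ncD: "\<forall>E\<in>T1. \<not> crossing D E" for D
    proof -
      have "D \<in> T"
      proof (rule max)
        show "D \<in> chords a b" using D \<open>m < b\<close> by (auto simp: chords_def)
        fix E assume "E \<in> T"
        then have "E = (a, b) \<or> E \<in> T1 \<or> E \<in> T2" using T_eq by auto
        then show "\<not> crossing D E"
          using ncD D \<open>m < b\<close> by (auto simp: T2_def chords_def crossing_def)
      qed
      then show ?thesis using D by (simp add: T1_def)
    qed
    then show ?thesis using nc by (auto simp: rooted_triangulations_def T1_def)
  qed
  moreover have "T2 \<in> rooted_triangulations m b"
  proof -
    have "D \<in> T2" if D: "D \<in> chords m b" and ncD: "\<forall>E\<in>T2. \<not> crossing D E" for D
    proof -
      have "D \<in> T"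
      proof (rule max)
        show "D \<in> chords a b" using D \<open>a + 1 \<le> m\<close> by (auto simp: chords_def)
        fix E assume "E \<in> T"
        then have "E = (a, b) \<or> E \<in> T1 \<or> E \<in> T2" using T_eq by auto
        then show "\<not> crossing D E"
          using ncD D \<open>a + 1 \<le> m\<close> by (auto simp: T1_def chords_def crossing_def)
      qed
      then show ?thesis using D by (simp add: T2_def)
    qed
    then show ?thesis using nc by (auto simp: rooted_triangulations_def T2_def)
  qed
  ultimately show thesis using that[of m T1 T2] \<open>a + 1 \<le> m\<close> \<open>m < b\<close> T_eq by simp
qed

text \<open>Recovers both pieces from the glued triangulation once the apex is known; this is the
  second half of injectivity below.\<close>

lemma glue_Int_chords:
  assumes "a < m" "m < b" "T1 \<in> rooted_triangulations a m" "T2 \<in> rooted_triangulations m b"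
  shows "insert (a, b) (T1 \<union> T2) \<inter> chords a m = T1"
    and "insert (a, b) (T1 \<union> T2) \<inter> chords m b = T2"
proof -
  have "T1 \<subseteq> chords a m" "T2 \<subseteq> chords m b"
    using assms by (auto simp: rooted_triangulations_def)
  moreover have "chords a m \<inter> chords m b = {}" "(a, b) \<notin> chords a m" "(a, b) \<notin> chords m b"
    using assms by (auto simp: chords_def)
  ultimately show "insert (a, b) (T1 \<union> T2) \<inter> chords a m = T1"
    "insert (a, b) (T1 \<union> T2) \<inter> chords m b = T2" by blast+
qed

lemma bij_betw_glue:
  assumes ab: "a + 2 \<le> b"
  shows "bij_betw (\<lambda>(m, T1, T2). insert (a, b) (T1 \<union> T2))
    (SIGMA m:{a<..<b}. rooted_triangulations a m \<times> rooted_triangulations m b)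
    (rooted_triangulations a b)"
proof (rule bij_betw_imageI)
  let ?S = "SIGMA m:{a<..<b}. rooted_triangulations a m \<times> rooted_triangulations m b"
  let ?g = "\<lambda>(m, T1, T2). insert (a, b) (T1 \<union> T2)"
  show "?g ` ?S = rooted_triangulations a b"
  proof
    show "?g ` ?S \<subseteq> rooted_triangulations a b"
      using glue_rooted_triangulations by auto
    show "rooted_triangulations a b \<subseteq> ?g ` ?S"
    proof
      fix T assume "T \<in> rooted_triangulations a b"
      then obtain m T1 T2 where "a < m" "m < b" "T1 \<in> rooted_triangulations a m"
        "T2 \<in> rooted_triangulations m b" "T = insert (a, b) (T1 \<union> T2)"
        using split_rooted_triangulation[OF ab] by metis
      then show "T \<in> ?g ` ?S" by (intro image_eqI[of _ _ "(m, T1, T2)"]) auto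
    qed
  qed
  \<comment> \<open>The apex is determined by the triangulation: if \<open>m < m'\<close>, the roots
    \<open>(a, m')\<close> and \<open>(m, b)\<close> would both be present and cross.\<close>
  have le: "m' \<le> m"
    if "a < m" "m < b" "a < m'" "m' < b"
      "T1' \<in> rooted_triangulations a m'" "T2 \<in> rooted_triangulations m b"
      "insert (a, b) (T1 \<union> T2) = insert (a, b) (T1' \<union> T2')"
      "insert (a, b) (T1 \<union> T2) \<in> rooted_triangulations a b"
    for m m' T1 T2 T1' T2'
  proof (rule ccontr)
    assume "\<not> m' \<le> m"
    then have "(a, m') \<in> insert (a, b) (T1 \<union> T2)" "(m, b) \<in> insert (a, b) (T1 \<union> T2)"
      using that root_mem[of T1' a m'] root_mem[of T2 m b] by auto
    then have "\<not> crossing (a, m') (m, b)"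
      using that(8) unfolding rooted_triangulations_def by blast
    then show False using that \<open>\<not> m' \<le> m\<close> by (simp add: crossing_def)
  qed
  show "inj_on ?g ?S"
  proof (rule inj_onI)
    fix x y assume "x \<in> ?S" "y \<in> ?S" "?g x = ?g y"
    then obtain m T1 T2 m' T1' T2' where xy: "x = (m, T1, T2)" "y = (m', T1', T2')"
      and *: "m \<in> {a<..<b}" "T1 \<in> rooted_triangulations a m" "T2 \<in> rooted_triangulations m b"
      "m' \<in> {a<..<b}" "T1' \<in> rooted_triangulations a m'" "T2' \<in> rooted_triangulations m' b"
      and eq: "insert (a, b) (T1 \<union> T2) = insert (a, b) (T1' \<union> T2')"
      by auto
    have tri: "insert (a, b) (T1 \<union> T2) \<in> rooted_triangulations a b"
      using * glue_rooted_triangulations by auto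
    have "m = m'"
      using le[of m m' T1' T2 T1 T2'] le[of m' m T1 T2' T1' T2] * eq tri by auto
    then show "x = y"
      unfolding xy using glue_Int_chords[of a m b T1 T2] glue_Int_chords[of a m b T1' T2'] * eq by auto
  qed
qed

section \<open>Weighted sums over triangulations\<close>

text \<open>The Catalan recursion with weights. The weight of the root is left out so that it can be
  restored in the induction and omitted for the amplitude.\<close>

lemma sum_rooted_triangulations_rec:
  fixes w :: "nat \<times> nat \<Rightarrow> 'a::comm_semiring_1"
  assumes ab: "a + 2 \<le> b"
  shows "(\<Sum>T\<in>rooted_triangulations a b. \<Prod>D\<in>T - {(a, b)}. w D) =
    (\<Sum>m\<in>{a<..<b}. (\<Sum>T\<in>rooted_triangulations a m. \<Prod>D\<in>T. w D) *
      (\<Sum>T\<in>rooted_triangulations m b. \<Prod>D\<in>T. w D))"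
proof -
  let ?S = "SIGMA m:{a<..<b}. rooted_triangulations a m \<times> rooted_triangulations m b"
  have "(\<Sum>T\<in>rooted_triangulations a b. \<Prod>D\<in>T - {(a, b)}. w D) =
    (\<Sum>(m, T1, T2)\<in>?S. \<Prod>D\<in>insert (a, b) (T1 \<union> T2) - {(a, b)}. w D)"
    by (subst sum.reindex_bij_betw[OF bij_betw_glue[OF ab], symmetric]) (simp add: case_prod_unfold)
  also have "\<dots> = (\<Sum>(m, T1, T2)\<in>?S. (\<Prod>D\<in>T1. w D) * (\<Prod>D\<in>T2. w D))"
  proof (intro sum.cong refl, clarify)
    fix m T1 T2 assume *: "m \<in> {a<..<b}" "T1 \<in> rooted_triangulations a m"
      "T2 \<in> rooted_triangulations m b"
    then have sub: "T1 \<subseteq> chords a m" "T2 \<subseteq> chords m b"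
      by (auto simp: rooted_triangulations_def)
    then have "(a, b) \<notin> T1" "(a, b) \<notin> T2" and disj: "T1 \<inter> T2 = {}"
      using * by (force simp: chords_def)+
    then have "insert (a, b) (T1 \<union> T2) - {(a, b)} = T1 \<union> T2" by auto
    then show "(\<Prod>D\<in>insert (a, b) (T1 \<union> T2) - {(a, b)}. w D) =
        (\<Prod>D\<in>T1. w D) * (\<Prod>D\<in>T2. w D)"
      using * disj by (simp add: prod.union_disjoint rooted_triangulations_finite_elem)
  qed
  also have "\<dots> = (\<Sum>m\<in>{a<..<b}. (\<Sum>T\<in>rooted_triangulations a m. \<Prod>D\<in>T. w D) *
      (\<Sum>T\<in>rooted_triangulations m b. \<Prod>D\<in>T. w D))"
    by (subst sum.Sigma[symmetric])
       (auto simp: finite_rooted_triangulations sum_product sum.cartesian_product)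
  finally show ?thesis .
qed

lemma interval_prod_split:
  fixes c :: "nat \<Rightarrow> 'a::comm_monoid_mult"
  assumes "a < m" "m < b"
  shows "(\<Prod>i\<in>{a<..<b}. c i) = (\<Prod>i\<in>{a<..<m}. c i) * c m * (\<Prod>i\<in>{m<..<b}. c i)"
proof -
  have "{a<..<b} = insert m ({a<..<m} \<union> {m<..<b})" using assms by auto
  then show ?thesis by (simp add: prod.union_disjoint ac_simps)
qed

text \<open>
  The summand at \<open>m\<close> equals \<open>c m\<close> divided by the product of all \<open>c i\<close>, so summing over \<open>m\<close>
  cancels the propagator of the root.
\<close>

lemma sum_splittings:
  fixes c :: "nat \<Rightarrow> real"
  assumes pos: "\<And>i. a < i \<Longrightarrow> i < b \<Longrightarrow> c i > 0"
  shows "(\<Sum>m\<in>{a<..<b}. 1 / (\<Prod>i\<in>{a<..<m}. c i) * (1 / (\<Prod>i\<in>{m<..<b}. c i))) =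
    (\<Sum>i\<in>{a<..<b}. c i) / (\<Prod>i\<in>{a<..<b}. c i)"
  unfolding sum_divide_distrib
proof (rule sum.cong[OF refl])
  fix m assume m: "m \<in> {a<..<b}"
  then have "c m > 0" using pos by simp
  then show "1 / (\<Prod>i\<in>{a<..<m}. c i) * (1 / (\<Prod>i\<in>{m<..<b}. c i)) =
      c m / (\<Prod>i\<in>{a<..<b}. c i)"
    using m by (simp add: interval_prod_split[of a m b c])
qed

text \<open>By induction and \<open>sum_splittings\<close>, the sum without the root factor is the
  sum of the \<open>c i\<close> over their product. The root weight is the reciprocal of that same
  sum, and positivity lets the two cancel.\<close>

lemma sum_rooted_triangulations:
  fixes c :: "nat \<Rightarrow> real"
  assumes "a < b" and "\<And>i. a < i \<Longrightarrow> i < b \<Longrightarrow> c i > 0"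
  shows "(\<Sum>T\<in>rooted_triangulations a b. \<Prod>D\<in>T. 1 / (\<Sum>i\<in>{fst D<..<snd D}. c i)) =
    1 / (\<Prod>i\<in>{a<..<b}. c i)"
  using assms
proof (induction "b - a" arbitrary: a b rule: less_induct)
  case less
  let ?w = "\<lambda>D. 1 / (\<Sum>i\<in>{fst D<..<snd D}. c i)"
  show ?case
  proof (cases "a + 2 \<le> b")
    case False
    then have "b = a + 1" using less.prems by simp
    moreover have "{a<..<a + 1} = {}" by auto
    ultimately show ?thesis by (simp add: rooted_triangulations_trivial)
  next
    case True
    have "a + 1 \<in> {a<..<b}" using True by simp
    then have pos: "(\<Sum>i\<in>{a<..<b}. c i) > 0"
      by (intro sum_pos) (use less.prems in auto)
    have "(\<Sum>T\<in>rooted_triangulations a b. \<Prod>D\<in>T. ?w D) =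
        ?w (a, b) * (\<Sum>T\<in>rooted_triangulations a b. \<Prod>D\<in>T - {(a, b)}. ?w D)"
      unfolding sum_distrib_left
      by (intro sum.cong refl prod.remove rooted_triangulations_finite_elem root_mem True)
    also have "(\<Sum>T\<in>rooted_triangulations a b. \<Prod>D\<in>T - {(a, b)}. ?w D) =
        (\<Sum>m\<in>{a<..<b}. 1 / (\<Prod>i\<in>{a<..<m}. c i) * (1 / (\<Prod>i\<in>{m<..<b}. c i)))"
      unfolding sum_rooted_triangulations_rec[OF True]
      by (intro sum.cong refl arg_cong2[of _ _ _ _ times] less.hyps less.prems) auto
    also have "\<dots> = (\<Sum>i\<in>{a<..<b}. c i) / (\<Prod>i\<in>{a<..<b}. c i)"
      by (rule sum_splittings) (use less.prems in auto)
    finally show ?thesis using pos by simp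
  qed
qed

section \<open>The amplitude on simplex kinematics\<close>

text \<open>The pair \<open>(1, n)\<close> is a side of the polygon and crosses no chord, so
  inserting or deleting it changes neither compatibility nor maximality.\<close>

lemma triangulations_eq:
  assumes "n \<ge> 3"
  shows "triangulations n = (\<lambda>T. T - {(1, n)}) ` rooted_triangulations 1 n"
    and "inj_on (\<lambda>T. T - {(1, n)}) (rooted_triangulations 1 n)"
proof -
  have chords: "chords 1 n = insert (1, n) (diagonals n)" and notin: "(1, n) \<notin> diagonals n"
    using assms by (auto simp: chords_def diagonals_def)
  have nc: "\<not> crossing (1, n) D" "\<not> crossing D (1, n)" if "D \<in> chords 1 n" for D
    using that by (auto simp: chords_def crossing_def)
  have root: "(1, n) \<in> T" if "T \<in> rooted_triangulations 1 n" for T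
    using root_mem[OF that] assms by simp
  show "inj_on (\<lambda>T. T - {(1, n)}) (rooted_triangulations 1 n)"
    by (rule inj_onI) (metis insert_Diff root)
  show "triangulations n = (\<lambda>T. T - {(1, n)}) ` rooted_triangulations 1 n"
  proof
    show "triangulations n \<subseteq> (\<lambda>T. T - {(1, n)}) ` rooted_triangulations 1 n"
    proof
      fix T assume T: "T \<in> triangulations n"
      then have "insert (1, n) T \<in> rooted_triangulations 1 n"
        using nc unfolding triangulations_def rooted_triangulations_def chords by blast
      moreover have "T = insert (1, n) T - {(1, n)}"
        using T notin by (auto simp: triangulations_def)
      ultimately show "T \<in> (\<lambda>T. T - {(1, n)}) ` rooted_triangulations 1 n" by blast
    qed
    show "(\<lambda>T. T - {(1, n)}) ` rooted_triangulations 1 n \<subseteq> triangulations n"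
    proof (rule image_subsetI)
      fix T assume T: "T \<in> rooted_triangulations 1 n"
      then show "T - {(1, n)} \<in> triangulations n"
        using nc notin unfolding triangulations_def rooted_triangulations_def chords by blast
    qed
  qed
qed

text \<open>The interval \<open>{a<..b}\<close> avoids the label 1, and it could contain both 2 and
  \<open>n\<close> only for \<open>(a, b) = (1, n)\<close>, which is not a diagonal. Only
  consecutive pairs survive.\<close>

lemma diagonal_invariant_simplex_kinematics:
  assumes s: "s \<in> simplex_kinematics n" and D: "D \<in> diagonals n"
  shows "diagonal_invariant s D = (\<Sum>i\<in>{fst D<..<snd D}. s i (i + 1))"
proof -
  obtain a b where [simp]: "D = (a, b)" by (cases D)
  have ab: "1 \<le> a" "a + 2 \<le> b" "b \<le> n" "\<not> (a = 1 \<and> b = n)"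
    using D by (auto simp: diagonals_def)
  let ?P = "{(i, j). i \<in> {a<..b} \<and> j \<in> {a<..b} \<and> i < j}"
  have "(\<Sum>(i, j)\<in>?P. s i j) = (\<Sum>(i, j)\<in>(\<lambda>i. (i, i + 1)) ` {a<..<b}. s i j)"
  proof (rule sum.mono_neutral_right)
    show "finite ?P" by (rule finite_subset[of _ "{..b} \<times> {..b}"]) auto
    show "(\<lambda>i. (i, i + 1)) ` {a<..<b} \<subseteq> ?P" by auto
    show "\<forall>x\<in>?P - (\<lambda>i. (i, i + 1)) ` {a<..<b}. (case x of (i, j) \<Rightarrow> s i j) = 0"
    proof clarify
      fix i j assume ij: "i \<in> {a<..b}" "j \<in> {a<..b}" "i < j"
        and "(i, j) \<notin> (\<lambda>i. (i, i + 1)) ` {a<..<b}"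
      then have "j \<noteq> i + 1" by auto
      moreover have "(i, j) \<noteq> (2, n)" using ij ab by auto
      ultimately show "s i j = 0"
        using s ij ab unfolding simplex_kinematics_def by auto
    qed
  qed
  also have "\<dots> = (\<Sum>i\<in>{a<..<b}. s i (i + 1))"
    by (subst sum.reindex) (auto simp: inj_on_def)
  finally show ?thesis by (simp add: diagonal_invariant_def)
qed

lemma biadjoint_amplitude_simplex_kinematics:
  assumes n: "n \<ge> 3" and s: "s \<in> simplex_kinematics n"
    and pos: "\<And>i. 1 < i \<Longrightarrow> i < n \<Longrightarrow> s i (i + 1) > 0"
  shows "biadjoint_amplitude n s = (\<Sum>i\<in>{1<..<n}. s i (i + 1)) / (\<Prod>i\<in>{1<..<n}. s i (i + 1))"
proof -
  let ?w = "\<lambda>D. 1 / (\<Sum>i\<in>{fst D<..<snd D}. s i (i + 1))"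
  have "biadjoint_amplitude n s = (\<Sum>T\<in>triangulations n. \<Prod>D\<in>T. ?w D)"
    unfolding biadjoint_amplitude_def triangulations_def
    using diagonal_invariant_simplex_kinematics[OF s]
    by (intro sum.cong prod.cong refl) auto
  also have "\<dots> = (\<Sum>T\<in>rooted_triangulations 1 n. \<Prod>D\<in>T - {(1, n)}. ?w D)"
    unfolding triangulations_eq(1)[OF n] by (subst sum.reindex[OF triangulations_eq(2)[OF n]]) simp
  \<comment> \<open>The recursion is applied once at the missing root \<open>(1, n)\<close>; both
    pieces keep their own roots, so the closed form applies to each.\<close>
  also have "\<dots> = (\<Sum>m\<in>{1<..<n}. 1 / (\<Prod>i\<in>{1<..<m}. s i (i + 1)) * (1 / (\<Prod>i\<in>{m<..<n}. s i (i + 1))))"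
  proof -
    have "1 + 2 \<le> n" using n by simp
    note rec = sum_rooted_triangulations_rec[OF this]
    show ?thesis
      by (subst rec, intro sum.cong refl arg_cong2[of _ _ _ _ times] sum_rooted_triangulations)
         (use pos in auto)
  qed
  also have "\<dots> = (\<Sum>i\<in>{1<..<n}. s i (i + 1)) / (\<Prod>i\<in>{1<..<n}. s i (i + 1))"
    by (rule sum_splittings) (use pos in auto)
  finally show ?thesis .
qed

text \<open>Ensures that the value of the amplitude does not rest on the convention
  \<open>1 / 0 = 0\<close>.\<close>

lemma diagonal_invariant_pos:
  assumes "s \<in> simplex_kinematics n" "D \<in> diagonals n"
    and "\<And>i. 1 < i \<Longrightarrow> i < n \<Longrightarrow> s i (i + 1) > 0"
  shows "diagonal_invariant s D > 0"
  unfolding diagonal_invariant_simplex_kinematics[OF assms(1,2)]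
proof (rule sum_pos)
  have "fst D + 1 \<in> {fst D<..<snd D}" using assms(2) by (auto simp: diagonals_def)
  then show "{fst D<..<snd D} \<noteq> {}" by blast
qed (use assms(2,3) in \<open>auto simp: diagonals_def\<close>)

section \<open>The Dirichlet integral\<close>

text \<open>The substitution \<open>u = t * x\<close> in Euler's integral. Nonnegative integrals are
  used so that the later exchange of integrals requires only measurability.\<close>

lemma nn_integral_Gamma_scaled:
  fixes a t :: real
  assumes "a > 0" "t > 0"
  shows "(\<integral>\<^sup>+x. ennreal (indicator {0..} x * x powr (a - 1) * exp (- t * x)) \<partial>lborel) =
    ennreal (Gamma a * t powr (- a))"
proof -
  let ?f = "\<lambda>u::real. ennreal (indicator {0..} u * u powr (a - 1) / exp u)"
  have "ennreal (Gamma a) = (\<integral>\<^sup>+u. ?f u \<partial>lborel)"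
    by (rule Gamma_conv_nn_integral_real) fact
  also have "\<dots> = ennreal t * (\<integral>\<^sup>+x. ?f (0 + t * x) \<partial>lborel)"
    using assms by (subst nn_integral_real_affine[of _ t 0]) auto
  also have "\<dots> = (\<integral>\<^sup>+x. ennreal (t powr a) *
      ennreal (indicator {0..} x * x powr (a - 1) * exp (- t * x)) \<partial>lborel)"
  proof (subst nn_integral_cmult[symmetric], measurable, intro nn_integral_cong)
    fix x :: real
    have "t * (t * x) powr (a - 1) = t powr a * x powr (a - 1)" if "x \<ge> 0"
      using assms that by (simp add: powr_mult powr_diff)
    then show "ennreal t * ?f (0 + t * x) =
        ennreal (t powr a) * ennreal (indicator {0..} x * x powr (a - 1) * exp (- t * x))"
      using assms
      by (auto simp: indicator_def exp_minus field_simps zero_le_mult_iff simp flip: ennreal_mult')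
  qed
  also have "\<dots> = ennreal (t powr a) *
      (\<integral>\<^sup>+x. ennreal (indicator {0..} x * x powr (a - 1) * exp (- t * x)) \<partial>lborel)"
    by (rule nn_integral_cmult) measurable
  finally have "ennreal (t powr (- a)) * ennreal (Gamma a) =
      ennreal (t powr (- a)) * ennreal (t powr a) *
      (\<integral>\<^sup>+x. ennreal (indicator {0..} x * x powr (a - 1) * exp (- t * x)) \<partial>lborel)"
    by (simp add: mult.assoc)
  also have "ennreal (t powr (- a)) * ennreal (t powr a) = 1"
    using assms by (simp add: powr_minus flip: ennreal_mult')
  finally show ?thesis using assms by (simp add: mult.commute ennreal_mult'')
qed

text \<open>
  Writing \<open>\<Gamma>(A) (1 + \<Sum>x)\<^sup>-\<^sup>A\<close> as an integral over \<open>t\<close> of \<open>t\<^sup>A\<^sup>-\<^sup>1 exp (- t (1 + \<Sum>x))\<close> decouples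
  the variables \<open>x\<^sub>i\<close>.
\<close>

lemma nn_integral_Dirichlet:
  fixes a :: "'i \<Rightarrow> real" and b :: real
  assumes I: "finite I" and a: "\<And>i. i \<in> I \<Longrightarrow> a i > 0" and b: "b > 0"
  shows "(\<integral>\<^sup>+x. ennreal ((\<Prod>i\<in>I. indicator {0..} (x i) * x i powr (a i - 1)) *
      (1 + (\<Sum>i\<in>I. x i)) powr (- (b + (\<Sum>i\<in>I. a i)))) \<partial>PiM I (\<lambda>_. lborel)) =
    ennreal (Gamma b * (\<Prod>i\<in>I. Gamma (a i)) / Gamma (b + (\<Sum>i\<in>I. a i)))"
    (is "?L = _")
proof -
  define A where "A = b + (\<Sum>i\<in>I. a i)"
  define M where "M = PiM I (\<lambda>_. lborel :: real measure)"
  have A: "A > 0" unfolding A_def using a b by (simp add: add_pos_nonneg sum_nonneg less_imp_le)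
  then have GA: "Gamma A > 0" by simp
  interpret P: product_sigma_finite "\<lambda>_::'i. lborel :: real measure" ..
  interpret M: sigma_finite_measure M unfolding M_def by (rule P.sigma_finite) fact
  interpret pair_sigma_finite M "lborel :: real measure" ..
  have meas_t: "(\<lambda>t::real. ennreal (indicator {0..} t * t powr (b - 1) * exp (- 1 * t)))
      \<in> borel_measurable lborel"
    by measurable
  have comp [measurable]: "(\<lambda>x. x i) \<in> borel_measurable M" if "i \<in> I" for i
    using measurable_component_singleton[OF that, of "\<lambda>_. lborel :: real measure"]
    by (simp add: M_def)
  let ?p = "\<lambda>x. \<Prod>i\<in>I. indicator {0..} (x i) * x i powr (a i - 1)"
  let ?h = "\<lambda>t::real. indicator {0..} t * t powr (A - 1)"
  \<comment> \<open>Integrating \<open>?K\<close> over \<open>t\<close> gives back the Dirichlet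
    integrand times \<open>Gamma A\<close>; integrating it over \<open>x\<close> gives a product of
    one-dimensional Gamma integrals.\<close>
  let ?K = "\<lambda>x t. ennreal (?p x) * ennreal (?h t * exp (- (1 + (\<Sum>i\<in>I. x i)) * t))"
  have p_nonneg: "?p x \<ge> 0" for x by (intro prod_nonneg) auto
  have in_x: "(\<integral>\<^sup>+t. ?K x t \<partial>lborel) =
      ennreal (Gamma A) * ennreal (?p x * (1 + (\<Sum>i\<in>I. x i)) powr (- A))" for x
  proof (cases "\<forall>i\<in>I. x i \<ge> 0")
    case True
    then have "1 + (\<Sum>i\<in>I. x i) > 0" by (simp add: add_pos_nonneg sum_nonneg)
    from nn_integral_Gamma_scaled[OF A this] show ?thesis
      using GA p_nonneg
      by (subst nn_integral_cmult) (auto simp: ac_simps simp flip: ennreal_mult')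
  next
    \<comment> \<open>Here \<open>1 + (\<Sum>i\<in>I. x i)\<close> may fail to be positive, but the
      indicators make both sides vanish.\<close>
    case False
    then obtain i where "i \<in> I" "x i < 0" by force
    then have "?p x = 0" using I by (intro prod_zero bexI[of _ i]) auto
    then show ?thesis by simp
  qed
  have G_nonneg: "(\<Prod>i\<in>I. Gamma (a i)) \<ge> 0"
    using a by (intro prod_nonneg) (simp add: less_imp_le)
  \<comment> \<open>The point \<open>t = 0\<close> is excluded since the scaled Gamma integral needs
    \<open>t > 0\<close>; it is a null set. For \<open>t < 0\<close> both sides are 0.\<close>
  have in_t: "(\<integral>\<^sup>+x. ?K x t \<partial>M) = ennreal (\<Prod>i\<in>I. Gamma (a i)) *
      ennreal (indicator {0..} t * t powr (b - 1) * exp (- 1 * t))" if "t \<noteq> 0" for t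
  proof (cases "t > 0")
    case True
    have "?K x t = ennreal (?h t * exp (- t)) *
        (\<Prod>i\<in>I. ennreal (indicator {0..} (x i) * x i powr (a i - 1) * exp (- t * x i)))" for x
    proof -
      have "exp (- (1 + (\<Sum>i\<in>I. x i)) * t) = exp (- t) * (\<Prod>i\<in>I. exp (- t * x i))"
        using I by (simp add: algebra_simps sum_distrib_left sum_negf flip: exp_sum exp_add)
      then show ?thesis
        by (simp add: prod_ennreal prod.distrib prod_nonneg ac_simps flip: ennreal_mult')
    qed
    then have "(\<integral>\<^sup>+x. ?K x t \<partial>M) = ennreal (?h t * exp (- t)) * (\<integral>\<^sup>+x.
        (\<Prod>i\<in>I. ennreal (indicator {0..} (x i) * x i powr (a i - 1) * exp (- t * x i))) \<partial>M)"
      by (simp add: nn_integral_cmult)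
    also have "\<dots> = ennreal (?h t * exp (- t)) * (\<Prod>i\<in>I. \<integral>\<^sup>+x.
        ennreal (indicator {0..} x * x powr (a i - 1) * exp (- t * x)) \<partial>lborel)"
      unfolding M_def using I by (subst P.product_nn_integral_prod) auto
    also have "\<dots> = ennreal (?h t * exp (- t)) * (\<Prod>i\<in>I. ennreal (Gamma (a i) * t powr (- a i)))"
      by (intro arg_cong2[of _ _ _ _ times] refl prod.cong nn_integral_Gamma_scaled True a)
    also have "\<dots> = ennreal (?h t * exp (- t) * (\<Prod>i\<in>I. Gamma (a i) * t powr (- a i)))"
      using a by (subst prod_ennreal) (auto intro!: mult_nonneg_nonneg less_imp_le simp flip: ennreal_mult')
    also have "(\<Prod>i\<in>I. Gamma (a i) * t powr (- a i)) =
        (\<Prod>i\<in>I. Gamma (a i)) * t powr (- (\<Sum>i\<in>I. a i))"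
      using True I by (simp add: prod.distrib powr_sum flip: sum_negf)
    also have "?h t * exp (- t) * ((\<Prod>i\<in>I. Gamma (a i)) * t powr (- (\<Sum>i\<in>I. a i))) =
        (\<Prod>i\<in>I. Gamma (a i)) * (indicator {0..} t * t powr (b - 1) * exp (- 1 * t))"
    proof -
      \<comment> \<open>The powers of \<open>t\<close> released by the \<open>x\<close> integrals
        lower the exponent from \<open>A - 1\<close> to \<open>b - 1\<close>, leaving Euler's
        integral for \<open>Gamma b\<close>.\<close>
      have "t powr (A - 1) * t powr (- (\<Sum>i\<in>I. a i)) = t powr (b - 1)"
        by (simp add: A_def flip: powr_add)
      then show ?thesis using True by (simp add: ac_simps)
    qed
    finally show ?thesis by (simp only: ennreal_mult'[OF G_nonneg])
  next
    case False
    then show ?thesis using that by simp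
  qed
  have "ennreal (Gamma A) * ?L = (\<integral>\<^sup>+x. \<integral>\<^sup>+t. ?K x t \<partial>lborel \<partial>M)"
    unfolding in_x unfolding A_def M_def[symmetric] by (rule nn_integral_cmult[symmetric]) measurable
  also have "\<dots> = (\<integral>\<^sup>+t. \<integral>\<^sup>+x. ?K x t \<partial>M \<partial>lborel)"
    by (rule Fubini'[symmetric]) measurable
  also have "\<dots> = (\<integral>\<^sup>+t. ennreal (\<Prod>i\<in>I. Gamma (a i)) *
      ennreal (indicator {0..} t * t powr (b - 1) * exp (- 1 * t)) \<partial>lborel)"
  proof (rule nn_integral_cong_AE)
    have "AE t in lborel. t \<noteq> (0::real)" by (rule AE_lborel_singleton)
    then show "AE t in lborel. (\<integral>\<^sup>+x. ?K x t \<partial>M) = ennreal (\<Prod>i\<in>I. Gamma (a i)) *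
      ennreal (indicator {0..} t * t powr (b - 1) * exp (- 1 * t))"
      by eventually_elim (rule in_t)
  qed
  also have "\<dots> = ennreal (\<Prod>i\<in>I. Gamma (a i)) * ennreal (Gamma b * 1 powr (- b))"
    by (subst nn_integral_cmult[OF meas_t]) (simp only: nn_integral_Gamma_scaled[OF b zero_less_one])
  also have "\<dots> = ennreal (Gamma b * (\<Prod>i\<in>I. Gamma (a i)))"
    using a b by (simp add: prod_nonneg less_imp_le mult.commute flip: ennreal_mult')
  finally have "ennreal (1 / Gamma A) * (ennreal (Gamma A) * ?L) =
      ennreal (1 / Gamma A) * ennreal (Gamma b * (\<Prod>i\<in>I. Gamma (a i)))" by simp
  moreover have "ennreal (1 / Gamma A) * ennreal (Gamma A) = 1"
    using GA by (simp flip: ennreal_mult')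
  ultimately show ?thesis
    using GA by (simp add: A_def flip: mult.assoc ennreal_mult')
qed

section \<open>The limit of the Gamma quotient\<close>

lemma tendsto_times_Gamma_at_right_0:
  fixes c :: real
  assumes "c > 0"
  shows "((\<lambda>\<alpha>. \<alpha> * Gamma (\<alpha> * c)) \<longlongrightarrow> 1 / c) (at_right 0)"
proof -
  have "((\<lambda>\<alpha>. Gamma (\<alpha> * c + 1) / c) \<longlongrightarrow> Gamma (0 * c + 1) / c) (at_right 0)"
    using assms by (intro tendsto_intros) auto
  moreover have "eventually (\<lambda>\<alpha>. Gamma (\<alpha> * c + 1) / c = \<alpha> * Gamma (\<alpha> * c)) (at_right 0)"
  proof (rule eventually_at_right_less[THEN eventually_mono])
    fix \<alpha> :: real assume "0 < \<alpha>"
    then have "\<alpha> * c > 0" using assms by simp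
    then have "\<alpha> * c \<notin> \<int>\<^sub>\<le>\<^sub>0" by (metis nonpos_Ints_cases of_int_le_0_iff not_less)
    from Gamma_plus1[OF this] show "Gamma (\<alpha> * c + 1) / c = \<alpha> * Gamma (\<alpha> * c)"
      using assms by simp
  qed
  ultimately show ?thesis by (simp add: tendsto_cong)
qed

text \<open>The exponent \<open>card I - 1\<close> gives one factor \<open>\<alpha>\<close> to each
  Gamma in the numerator and one to the Gamma in the denominator, so every factor has a finite
  nonzero limit.\<close>

lemma tendsto_Gamma_quotient:
  fixes c :: "'i \<Rightarrow> real"
  assumes I: "finite I" "I \<noteq> {}" and c: "\<And>i. i \<in> I \<Longrightarrow> c i > 0"
  shows "((\<lambda>\<alpha>. \<alpha> ^ (card I - 1) * ((\<Prod>i\<in>I. Gamma (\<alpha> * c i)) / Gamma (\<alpha> * (\<Sum>i\<in>I. c i))))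
    \<longlongrightarrow> (\<Sum>i\<in>I. c i) / (\<Prod>i\<in>I. c i)) (at_right 0)"
proof -
  let ?S = "\<Sum>i\<in>I. c i"
  have S: "?S > 0" using I c by (simp add: sum_pos)
  have "((\<lambda>\<alpha>. (\<Prod>i\<in>I. \<alpha> * Gamma (\<alpha> * c i)) / (\<alpha> * Gamma (\<alpha> * ?S)))
      \<longlongrightarrow> (\<Prod>i\<in>I. 1 / c i) / (1 / ?S)) (at_right 0)"
    using S c by (intro tendsto_divide tendsto_prod tendsto_times_Gamma_at_right_0) auto
  moreover have "eventually (\<lambda>\<alpha>. (\<Prod>i\<in>I. \<alpha> * Gamma (\<alpha> * c i)) / (\<alpha> * Gamma (\<alpha> * ?S)) =
      \<alpha> ^ (card I - 1) * ((\<Prod>i\<in>I. Gamma (\<alpha> * c i)) / Gamma (\<alpha> * ?S))) (at_right 0)"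
  proof (rule eventually_at_right_less[THEN eventually_mono])
    fix \<alpha> :: real assume "0 < \<alpha>"
    moreover have "\<alpha> ^ card I = \<alpha> * \<alpha> ^ (card I - 1)"
      using I by (metis card_gt_0_iff power_eq_if not_less0 neq0_conv)
    ultimately show "(\<Prod>i\<in>I. \<alpha> * Gamma (\<alpha> * c i)) / (\<alpha> * Gamma (\<alpha> * ?S)) =
      \<alpha> ^ (card I - 1) * ((\<Prod>i\<in>I. Gamma (\<alpha> * c i)) / Gamma (\<alpha> * ?S))"
      by (simp add: prod.distrib)
  qed
  moreover have "(\<Prod>i\<in>I. 1 / c i) / (1 / ?S) = ?S / (\<Prod>i\<in>I. c i)"
    by (simp add: prod_dividef)
  ultimately show ?thesis by (simp add: tendsto_cong)
qed

section \<open>Evaluation of the stringy integral\<close>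

lemma has_bochner_integral_stringy_integrand:
  fixes s :: "nat \<Rightarrow> nat \<Rightarrow> real"
  assumes k: "k \<ge> 2" and s: "\<And>i. i \<in> {2..k+1} \<Longrightarrow> s i (i + 1) > 0" and \<alpha>: "\<alpha> > 0"
  shows "has_bochner_integral (PiM {1..k-1} (\<lambda>_. lborel))
    (\<lambda>x. indicator (PiE {1..k-1} (\<lambda>_. {0..})) x *\<^sub>R stringy_integrand k \<alpha> s x)
    ((\<Prod>i=2..k+1. Gamma (\<alpha> * s i (i + 1))) / Gamma (\<alpha> * (\<Sum>i=2..k+1. s i (i + 1))))"
proof -
  let ?I = "{1..k-1}"
  define M where "M = PiM ?I (\<lambda>_. lborel :: real measure)"
  define a where "a i = \<alpha> * s (i + 2) (i + 3)" for i
  define b where "b = \<alpha> * s 2 3"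
  have a: "a i > 0" if "i \<in> ?I" for i
  proof -
    have "i + 2 \<in> {2..k+1}" using that k by auto
    from s[OF this] \<alpha> show ?thesis by (simp add: a_def eval_nat_numeral)
  qed
  have b: "b > 0" using s[of 2] \<alpha> k by (simp add: b_def eval_nat_numeral)
  \<comment> \<open>There are \<open>k\<close> planar variables but only \<open>k - 1\<close>
    integration variables. The index 2 is left over and supplies the parameter \<open>b\<close>,
    attached to the constant 1 in \<open>1 + (\<Sum>i\<in>?I. x i)\<close>.\<close>
  have split: "{2..k+1} = insert 2 ((\<lambda>i. i + 2) ` ?I)"
  proof -
    have "(\<lambda>i. i + 2) ` ?I = {1 + 2..k - 1 + 2}" by (rule image_add_atLeastAtMost')
    then show ?thesis using k by auto
  qed
  have inj: "inj_on (\<lambda>i. i + 2) ?I" and notin: "2 \<notin> (\<lambda>i. i + 2) ` ?I"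
    by (auto simp: inj_on_def)
  have fin: "finite ((\<lambda>i. i + 2) ` ?I)" by simp
  have sum: "\<alpha> * (\<Sum>i=2..k+1. s i (i + 1)) = b + (\<Sum>i\<in>?I. a i)"
    unfolding split sum.insert[OF fin notin] sum.reindex[OF inj] a_def b_def
    by (simp add: eval_nat_numeral distrib_left sum_distrib_left)
  have prod: "(\<Prod>i=2..k+1. Gamma (\<alpha> * s i (i + 1))) = Gamma b * (\<Prod>i\<in>?I. Gamma (a i))"
    unfolding split prod.insert[OF fin notin] prod.reindex[OF inj] a_def b_def
    by (simp add: eval_nat_numeral)
  let ?f = "\<lambda>x. indicator (PiE ?I (\<lambda>_. {0..})) x *\<^sub>R stringy_integrand k \<alpha> s x"
  let ?g = "\<lambda>x. (\<Prod>i\<in>?I. indicator {0..} (x i) * x i powr (a i - 1)) *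
      (1 + (\<Sum>i\<in>?I. x i)) powr (- (b + (\<Sum>i\<in>?I. a i)))"
  have fg: "?f x = ?g x" if "x \<in> space M" for x
  proof (cases "\<forall>i\<in>?I. x i \<ge> 0")
    case True
    \<comment> \<open>Membership in \<open>PiE\<close> also demands extensionality, which comes from
      \<open>x \<in> space M\<close>.\<close>
    then have "x \<in> PiE ?I (\<lambda>_. {0..})" using that by (auto simp: M_def space_PiM PiE_iff)
    moreover have "(\<Prod>i\<in>?I. 1 / x i * x i powr (\<alpha> * s (i + 2) (i + 3))) =
        (\<Prod>i\<in>?I. indicator {0..} (x i) * x i powr (a i - 1))"
    proof (rule prod.cong[OF refl])
      fix i assume "i \<in> ?I"
      then show "1 / x i * x i powr (\<alpha> * s (i + 2) (i + 3)) =
          indicator {0..} (x i) * x i powr (a i - 1)"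
        \<comment> \<open>At \<open>x i = 0\<close> both sides are 0 by the conventions for
          \<open>/\<close> and \<open>powr\<close>, so the integrands agree everywhere on
          \<open>M\<close>.\<close>
        using True by (cases "x i = 0") (auto simp: a_def powr_diff)
    qed
    moreover have "- \<alpha> * (\<Sum>i=2..k+1. s i (i + 1)) = - (b + (\<Sum>i\<in>?I. a i))"
      unfolding sum[symmetric] by simp
    ultimately show ?thesis by (simp only: stringy_integrand_def indicator_simps scaleR_one)
  next
    case False
    then have "x \<notin> PiE ?I (\<lambda>_. {0..})" by auto
    moreover obtain i where "i \<in> ?I" "x i < 0" using False by force
    then have "(\<Prod>i\<in>?I. indicator {0..} (x i) * x i powr (a i - 1)) = 0"
      by (intro prod_zero bexI[of _ i]) auto
    ultimately show ?thesis by simp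
  qed
  have comp [measurable]: "(\<lambda>x. x i) \<in> borel_measurable M" if "i \<in> ?I" for i
    using measurable_component_singleton[OF that, of "\<lambda>_. lborel :: real measure"]
    by (simp add: M_def)
  have "has_bochner_integral M ?g (Gamma b * (\<Prod>i\<in>?I. Gamma (a i)) / Gamma (b + (\<Sum>i\<in>?I. a i)))"
  proof (rule has_bochner_integral_nn_integral)
    show "?g \<in> borel_measurable M" by measurable
    show "AE x in M. 0 \<le> ?g x" by (intro AE_I2 mult_nonneg_nonneg prod_nonneg) auto
    show "0 \<le> Gamma b * (\<Prod>i\<in>?I. Gamma (a i)) / Gamma (b + (\<Sum>i\<in>?I. a i))"
      using a b by (intro divide_nonneg_nonneg mult_nonneg_nonneg prod_nonneg ballI)
        (auto intro!: less_imp_le Gamma_real_pos add_pos_nonneg sum_nonneg)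
    show "(\<integral>\<^sup>+x. ennreal (?g x) \<partial>M) =
        ennreal (Gamma b * (\<Prod>i\<in>?I. Gamma (a i)) / Gamma (b + (\<Sum>i\<in>?I. a i)))"
      unfolding M_def by (rule nn_integral_Dirichlet) (use a b in auto)
  qed
  then show ?thesis
    unfolding sum prod M_def[symmetric] using fg by (subst has_bochner_integral_cong) auto
qed

text \<open>Integrability is asserted because the Lebesgue integral of a non-integrable function is
  0 by convention, and convergence because \<open>Lim\<close> alone does not imply it. Simplex
  kinematics is assumed only where the amplitude occurs; the remaining claims involve just the
  planar variables.\<close>

theorem mainTheorem4:
  fixes k :: nat and s :: "nat \<Rightarrow> nat \<Rightarrow> real"
  assumes "k \<ge> 2"
    and "\<And>i. i \<in> {2..k+1} \<Longrightarrow> s i (i + 1) > 0"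
  shows "(\<forall>\<alpha>>0.
           set_integrable (PiM {1..k-1} (\<lambda>_. lborel)) (PiE {1..k-1} (\<lambda>_. {0..}))
             (stringy_integrand k \<alpha> s) \<and>
           stringy_integral k \<alpha> s =
             \<alpha> ^ (k - 1) * ((\<Prod>i=2..k+1. Gamma (\<alpha> * s i (i + 1))) /
               Gamma (\<alpha> * (\<Sum>i=2..k+1. s i (i + 1))))) \<and>
         ((\<lambda>\<alpha>. stringy_integral k \<alpha> s) \<longlongrightarrow> simplex_amplitude k s) (at_right 0) \<and>
         (s \<in> simplex_kinematics (k + 2) \<longrightarrow>
           (\<forall>D\<in>diagonals (k + 2). diagonal_invariant s D \<noteq> 0) \<and>
           simplex_amplitude k s = biadjoint_amplitude (k + 2) s) \<and>
         simplex_amplitude k s = (\<Sum>i=2..k+1. s i (i + 1)) / (\<Prod>i=2..k+1. s i (i + 1))"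
proof -
  let ?J = "{2..k+1}"
  let ?m = "(\<Sum>i\<in>?J. s i (i + 1)) / (\<Prod>i\<in>?J. s i (i + 1))"
  let ?G = "\<lambda>\<alpha>. \<alpha> ^ (k - 1) * ((\<Prod>i\<in>?J. Gamma (\<alpha> * s i (i + 1))) /
    Gamma (\<alpha> * (\<Sum>i\<in>?J. s i (i + 1))))"
  have bochner: "has_bochner_integral (PiM {1..k-1} (\<lambda>_. lborel))
      (\<lambda>x. indicator (PiE {1..k-1} (\<lambda>_. {0..})) x *\<^sub>R stringy_integrand k \<alpha> s x)
      ((\<Prod>i\<in>?J. Gamma (\<alpha> * s i (i + 1))) / Gamma (\<alpha> * (\<Sum>i\<in>?J. s i (i + 1))))"
    if "\<alpha> > 0" for \<alpha>
    by (rule has_bochner_integral_stringy_integrand) (use assms that in auto)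
  have integrable: "set_integrable (PiM {1..k-1} (\<lambda>_. lborel)) (PiE {1..k-1} (\<lambda>_. {0..}))
      (stringy_integrand k \<alpha> s)" if "\<alpha> > 0" for \<alpha>
    using bochner[OF that] unfolding set_integrable_def
    by (rule has_bochner_integral_iff[THEN iffD1, THEN conjunct1])
  have value_eq: "stringy_integral k \<alpha> s = ?G \<alpha>" if "\<alpha> > 0" for \<alpha>
    using has_bochner_integral_integral_eq[OF bochner[OF that]]
    unfolding stringy_integral_def set_lebesgue_integral_def by simp
  \<comment> \<open>The index set \<open>?J\<close> has \<open>k\<close> elements, which matches the
    prefactor exponent \<open>k - 1\<close>.\<close>
  have "(?G \<longlongrightarrow> ?m) (at_right 0)"
    using tendsto_Gamma_quotient[of ?J "\<lambda>i. s i (i + 1)"] assms by simp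
  moreover have "eventually (\<lambda>\<alpha>. ?G \<alpha> = stringy_integral k \<alpha> s) (at_right 0)"
    using value_eq by (intro eventually_at_right_less[THEN eventually_mono]) simp
  ultimately have lim: "((\<lambda>\<alpha>. stringy_integral k \<alpha> s) \<longlongrightarrow> ?m) (at_right 0)"
    by (rule Lim_transform_eventually)
  then have amp: "simplex_amplitude k s = ?m"
    unfolding simplex_amplitude_def by (intro tendsto_Lim) auto
  \<comment> \<open>The interior vertices cut off by the root edge \<open>(1, k + 2)\<close> are
    exactly the indices of the planar variables.\<close>
  have interval: "{1<..<k + 2} = ?J" by auto
  have pos: "s i (i + 1) > 0" if "1 < i" "i < k + 2" for i
    using assms(2)[of i] that by simp
  have "biadjoint_amplitude (k + 2) s = ?m" if "s \<in> simplex_kinematics (k + 2)"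
    using biadjoint_amplitude_simplex_kinematics[of "k + 2" s] that pos assms(1)
    unfolding interval by simp
  moreover have "diagonal_invariant s D \<noteq> 0"
    if "s \<in> simplex_kinematics (k + 2)" "D \<in> diagonals (k + 2)" for D
    using diagonal_invariant_pos[of s "k + 2" D] that pos by simp
  ultimately show ?thesis
    using integrable value_eq lim amp by simp
qed

end
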